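(* For any $\varepsilon>0$, there is an instance of a biobjective optimization problem that admits a quasi-$1$-exact $(1+\varepsilon)$-approximation set of minimum cardinality (among all quasi-$1$-exact $(1+\varepsilon)$-approximation sets for the instance) consisting of strictly dominated solutions only.
   Context: An instance of a biobjective optimization problem is a pair $(X,f)$ with a set $X$ of feasible solutions and $f=(f_1,f_2)$, $f_i:X\to\mathbb{Q}_{>0}$, both to be minimized; the set of image points $f(X)$ is finite. A solution $x\in X$ strictly dominates $x'\in X$ if $f_i(x)<f_i(x')$ for $i=1,2$; $x'$ is strictly dominated if some $x\in X$ strictly dominates it. Quasi-$1$-exact $(1+\varepsilon)$-dominance: $x\preceq_\varepsilon^{(1)}x'$ iff $f_i(x)\le(1+\varepsilon)f_i(x')$ for $i=1,2$ and $f_j(x)\le f_j(x')$ for at least one $j\in\{1,2\}$. A quasi-$1$-exact $(1+\varepsilon)$-approximation set is a set $P\subseteq X$ such that for every $x'\in X$ there is $x\in P$ with $x\preceq_\varepsilon^{(1)}x'$. *)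

theory Defs
  imports Complex_Main "HOL-Library.Equipollence"
begin

text \<open>The set of feasible solutions is required to be nonempty: for an empty set the empty set is an
  approximation set, and statements about its elements hold vacuously.\<close>

definition biobjective_instance :: "'a set \<Rightarrow> ('a \<Rightarrow> rat \<times> rat) \<Rightarrow> bool" where
  "biobjective_instance X f \<longleftrightarrow>
     X \<noteq> {} \<and> (\<forall>x\<in>X. 0 < fst (f x) \<and> 0 < snd (f x)) \<and> finite (f ` X)"

definition strictly_dominates :: "('a \<Rightarrow> rat \<times> rat) \<Rightarrow> 'a \<Rightarrow> 'a \<Rightarrow> bool" where
  "strictly_dominates f x x' \<longleftrightarrow> fst (f x) < fst (f x') \<and> snd (f x) < snd (f x')"

definition strictly_dominated :: "'a set \<Rightarrow> ('a \<Rightarrow> rat \<times> rat) \<Rightarrow> 'a \<Rightarrow> bool" where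
  "strictly_dominated X f x' \<longleftrightarrow> (\<exists>x\<in>X. strictly_dominates f x x')"

definition quasi_1_exact_dominates ::
    "real \<Rightarrow> ('a \<Rightarrow> rat \<times> rat) \<Rightarrow> 'a \<Rightarrow> 'a \<Rightarrow> bool" where
  "quasi_1_exact_dominates \<epsilon> f x x' \<longleftrightarrow>
     of_rat (fst (f x)) \<le> (1 + \<epsilon>) * of_rat (fst (f x')) \<and>
     of_rat (snd (f x)) \<le> (1 + \<epsilon>) * of_rat (snd (f x')) \<and>
     (fst (f x) \<le> fst (f x') \<or> snd (f x) \<le> snd (f x'))"

definition quasi_1_exact_approx_set ::
    "real \<Rightarrow> 'a set \<Rightarrow> ('a \<Rightarrow> rat \<times> rat) \<Rightarrow> 'a set \<Rightarrow> bool" where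
  "quasi_1_exact_approx_set \<epsilon> X f P \<longleftrightarrow>
     P \<subseteq> X \<and> (\<forall>x'\<in>X. \<exists>x\<in>P. quasi_1_exact_dominates \<epsilon> f x x')"

text \<open>Cardinalities are compared by \<open>\<lesssim>\<close>, since \<open>card\<close> would assign 0 to infinite approximation
  sets, which exist when infinitely many solutions share an image point.\<close>

definition min_quasi_1_exact_approx_set ::
    "real \<Rightarrow> 'a set \<Rightarrow> ('a \<Rightarrow> rat \<times> rat) \<Rightarrow> 'a set \<Rightarrow> bool" where
  "min_quasi_1_exact_approx_set \<epsilon> X f P \<longleftrightarrow>
     quasi_1_exact_approx_set \<epsilon> X f P \<and>
     (\<forall>Q. quasi_1_exact_approx_set \<epsilon> X f Q \<longrightarrow> P \<lesssim> Q)"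

end

theory Submission
  imports Defs
begin

text \<open>Choose rationals \<open>1 < a < b < 1 + \<epsilon> < c < d < (1 + \<epsilon>) a\<close> and consider the image points
  \<open>(b, d)\<close>, \<open>(d, b)\<close>, \<open>(a, c)\<close>, \<open>(c, a)\<close>, \<open>(1, d)\<close>, \<open>(d, 1)\<close>. The first two form an approximation
  set, and they are strictly dominated by \<open>(a, c)\<close> and \<open>(c, a)\<close>: each of them covers the dominator
  of the other one. Covering \<open>(1, d)\<close> requires a first coordinate of at most \<open>1 + \<epsilon>\<close> and covering
  \<open>(d, 1)\<close> a second coordinate of at most \<open>1 + \<epsilon>\<close>; no point satisfies both, so two solutions are
  needed.\<close>

lemma doubleton_lepoll:
  assumes "u \<in> Q" "v \<in> Q" "u \<noteq> v"
  shows "{x, y} \<lesssim> Q"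
  unfolding lepoll_def
  by (rule exI[of _ "\<lambda>z. if z = x then u else v"]) (use assms in \<open>auto simp: inj_on_def\<close>)

theorem proposition4p1:
  fixes \<epsilon> :: real
  assumes "\<epsilon> > 0"
  shows "\<exists>(X :: nat set) (f :: nat \<Rightarrow> rat \<times> rat).
           biobjective_instance X f \<and>
           (\<exists>P. min_quasi_1_exact_approx_set \<epsilon> X f P \<and>
                (\<forall>x\<in>P. strictly_dominated X f x))"
proof -
  obtain a where a: "1 < real_of_rat a" "real_of_rat a < 1 + \<epsilon>"
    using of_rat_dense[of 1 "1 + \<epsilon>"] assms by auto
  obtain b where b: "real_of_rat a < real_of_rat b" "real_of_rat b < 1 + \<epsilon>"
    using of_rat_dense[OF a(2)] by auto
  have "1 + \<epsilon> < (1 + \<epsilon>) * real_of_rat a"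
    using a(1) assms by simp
  then obtain c where c: "1 + \<epsilon> < real_of_rat c" "real_of_rat c < (1 + \<epsilon>) * real_of_rat a"
    using of_rat_dense by blast
  obtain d where d: "real_of_rat c < real_of_rat d" "real_of_rat d < (1 + \<epsilon>) * real_of_rat a"
    using of_rat_dense[OF c(2)] by auto
  have "real_of_rat b < real_of_rat c"
    using b c by simp
  with a(1) b(1) d(1) have ord: "1 < a" "a < b" "b < c" "c < d"
    by (simp_all add: of_rat_less)
  have scale: "real_of_rat s \<le> (1 + \<epsilon>) * real_of_rat t" if "0 < t" "s \<le> t" for s t
  proof -
    have "real_of_rat s \<le> real_of_rat t"
      using that by (simp add: of_rat_less_eq)
    also have "\<dots> \<le> (1 + \<epsilon>) * real_of_rat t"
      using that assms by simp
    finally show ?thesis .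
  qed
  define f where "f n = [(b, d), (d, b), (a, c), (c, a), (1, d), (d, 1)] ! n" for n :: nat
  define X :: "nat set" where "X = {0, 1, 2, 3, 4, 5}"
  have f_simps [simp]: "f 0 = (b, d)" "f (Suc 0) = (d, b)" "f 2 = (a, c)" "f 3 = (c, a)"
    "f 4 = (1, d)" "f 5 = (d, 1)"
    by (simp_all add: f_def)
  have inst: "biobjective_instance X f"
    using ord by (auto simp: biobjective_instance_def X_def)
  have dom: "\<forall>x\<in>{0, 1}. strictly_dominated X f x"
    using ord by (auto simp: strictly_dominated_def strictly_dominates_def X_def)
  \<comment> \<open>Solutions 2 and 3 are covered exactly in the coordinate where \<open>b\<close>
    meets \<open>c\<close>; in the other, \<open>d < (1 + \<epsilon>) a\<close>. For 4 and 5 the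
    equal coordinates \<open>d\<close> are exact and \<open>b < 1 + \<epsilon>\<close>.\<close>
  have cov: "quasi_1_exact_dominates \<epsilon> f 0 0" "quasi_1_exact_dominates \<epsilon> f 1 1"
    "quasi_1_exact_dominates \<epsilon> f 1 2" "quasi_1_exact_dominates \<epsilon> f 0 3"
    "quasi_1_exact_dominates \<epsilon> f 0 4" "quasi_1_exact_dominates \<epsilon> f 1 5"
    using ord b c d scale[of b b] scale[of d d] scale[of c b]
    by (simp_all add: quasi_1_exact_dominates_def)
  then have approx: "quasi_1_exact_approx_set \<epsilon> X f {0, 1}"
    by (auto simp: quasi_1_exact_approx_set_def X_def)
  \<comment> \<open>Every image point has \<open>c\<close> or \<open>d\<close> as a coordinate, and
    both exceed \<open>1 + \<epsilon>\<close>.\<close>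
  have single: "\<not> (quasi_1_exact_dominates \<epsilon> f x 4 \<and> quasi_1_exact_dominates \<epsilon> f x 5)"
    if "x \<in> X" for x
    using that c(1) d(1) by (auto simp: X_def quasi_1_exact_dominates_def)
  have "{0, 1 :: nat} \<lesssim> Q" if Q: "quasi_1_exact_approx_set \<epsilon> X f Q" for Q
  proof -
    have "4 \<in> X" "5 \<in> X"
      by (simp_all add: X_def)
    with Q obtain u v where uv: "u \<in> Q" "quasi_1_exact_dominates \<epsilon> f u 4"
        "v \<in> Q" "quasi_1_exact_dominates \<epsilon> f v 5"
      unfolding quasi_1_exact_approx_set_def by meson
    moreover have "u \<noteq> v"
      using Q uv single unfolding quasi_1_exact_approx_set_def by blast
    ultimately show ?thesis
      by (intro doubleton_lepoll)
  qed
  with inst dom approx show ?thesis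
    unfolding min_quasi_1_exact_approx_set_def by blast
qed

end
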